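(* Let $n$ be an even positive integer. There is no bounded domain $D\subset\mathbb R^n$ with $C^2$-smooth boundary that is polynomially integrable.
   Context: A domain is a nonempty connected open set. For a bounded domain $D\subset\mathbb R^n$, $\omega\in S^{n-1}$ and $t\in\mathbb R$, the section-volume function $V_D(\omega,t)$ is the $(n-1)$-dimensional volume of $D\cap\{x\in\mathbb R^n:\langle\omega,x\rangle=t\}$, i.e. the Radon transform of the characteristic function $\chi_D$. The domain $D$ is called polynomially integrable if there are an integer $N\ge 0$ and real-valued functions $a_0,\dots,a_N$ on $S^{n-1}$ such that $V_D(\omega,t)=\sum_{j=0}^N a_j(\omega)t^j$ for all $(\omega,t)\in S^{n-1}\times\mathbb R$ such that the hyperplane $\{\langle\omega,x\rangle=t\}$ intersects $D$. *)

theory Defs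
  imports "HOL-Analysis.Analysis"
begin

definition is_domain :: "'a::topological_space set \<Rightarrow> bool" where
  "is_domain D \<longleftrightarrow> D \<noteq> {} \<and> connected D \<and> open D"

definition orthonormal_basis_of :: "'a::euclidean_space set \<Rightarrow> 'a set \<Rightarrow> bool" where
  "orthonormal_basis_of B S \<longleftrightarrow>
     pairwise orthogonal B \<and> (\<forall>b\<in>B. norm b = 1) \<and> span B = S"

lemma orthonormal_basis_of_exists:
  assumes "subspace S"
  shows "\<exists>B. orthonormal_basis_of B S"
  using orthonormal_basis_subspace[OF assms] unfolding orthonormal_basis_of_def by metis

lemma finite_orthonormal_basis_of:
  assumes "orthonormal_basis_of B S"
  shows "finite B"
  using assms pairwise_orthogonal_imp_finite unfolding orthonormal_basis_of_def by blast

(* The (n-1)-dimensional Lebesgue measure on the hyperplane {x. \<omega> \<bullet> x = t}, where norm \<omega> = 1,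
   regarded as a Borel measure on the ambient space: Lebesgue measure on the coordinates
   (c b) with respect to an orthonormal basis B of the linear hyperplane orthogonal to \<omega>
   is pushed forward along the isometry c \<mapsto> t \<omega> + (\<Sum>b\<in>B. c b b).  The construction mirrors the
   definition of lborel.  The choice of B is immaterial, since two orthonormal bases differ
   by an orthogonal transformation. *)
definition hyperplane_measure :: "'a::euclidean_space \<Rightarrow> real \<Rightarrow> 'a measure" where
  "hyperplane_measure \<omega> t =
     (let B = (SOME B. orthonormal_basis_of B {x. \<omega> \<bullet> x = 0})
      in distr (\<Pi>\<^sub>M b\<in>B. lborel) borel (\<lambda>c. t *\<^sub>R \<omega> + (\<Sum>b\<in>B. c b *\<^sub>R b)))"

definition section_volume :: "'a::euclidean_space set \<Rightarrow> 'a \<Rightarrow> real \<Rightarrow> real" where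
  "section_volume D \<omega> t = measure (hyperplane_measure \<omega> t) (D \<inter> {x. \<omega> \<bullet> x = t})"

definition polynomially_integrable :: "'a::euclidean_space set \<Rightarrow> bool" where
  "polynomially_integrable D \<longleftrightarrow>
     (\<exists>(N::nat) (a :: nat \<Rightarrow> 'a \<Rightarrow> real).
        \<forall>\<omega>\<in>sphere 0 1. \<forall>t. D \<inter> {x. \<omega> \<bullet> x = t} \<noteq> {} \<longrightarrow>
          section_volume D \<omega> t = (\<Sum>j\<le>N. a j \<omega> * t ^ j))"

definition C2_on :: "'a::real_normed_vector set \<Rightarrow> ('a \<Rightarrow> 'b::real_normed_vector) \<Rightarrow> bool" where
  "C2_on U f \<longleftrightarrow>
     (\<exists>(f' :: 'a \<Rightarrow> 'a \<Rightarrow>\<^sub>L 'b) (f'' :: 'a \<Rightarrow> 'a \<Rightarrow>\<^sub>L ('a \<Rightarrow>\<^sub>L 'b)).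
        (\<forall>x\<in>U. (f has_derivative blinfun_apply (f' x)) (at x)) \<and>
        (\<forall>x\<in>U. (f' has_derivative blinfun_apply (f'' x)) (at x)) \<and>
        continuous_on U f'')"

(* An embedded hypersurface of class C^2: locally a regular level set of a C^2 function. *)
definition C2_hypersurface :: "'a::euclidean_space set \<Rightarrow> bool" where
  "C2_hypersurface S \<longleftrightarrow>
     (\<forall>p\<in>S. \<exists>U (\<rho> :: 'a \<Rightarrow> real). open U \<and> p \<in> U \<and> C2_on U \<rho> \<and>
        (\<forall>x\<in>U. frechet_derivative \<rho> (at x) \<noteq> (\<lambda>_. 0)) \<and>
        S \<inter> U = {x \<in> U. \<rho> x = 0})"

end

theory Submission
  imports Defs "HOL-Computational_Algebra.Polynomial"
begin

text \<open>
  Let \<open>p\<close> be a point of the closure of \<open>D\<close> that is farthest from the origin, at distance \<open>R\<close>, and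
  let \<open>\<omega> = p / R\<close>. Since \<open>D\<close> lies in the ball of radius \<open>R\<close> about the origin, the section of \<open>D\<close> at
  height \<open>R - s\<close> has volume at most a constant times \<open>s powr ((n - 1) / 2)\<close>. Since the boundary is
  \<open>C\<^sup>2\<close>, \<open>D\<close> contains a ball whose boundary touches that of \<open>D\<close> at \<open>p\<close>, which gives a lower bound of
  the same order. For even \<open>n\<close> the exponent is not an integer, so no polynomial has this order of
  vanishing.
\<close>

section \<open>Interior tangent balls at a C2 boundary\<close>

text \<open>Near \<open>p\<close>, \<open>\<rho>\<close> differs from its linear part by at most a
  multiple of the squared distance, so it keeps one sign on a small ball tangent to the level set at
  \<open>p\<close>. This ball misses the frontier; a segment on which \<open>\<rho>\<close> keeps
  the same sign joins it to a point of \<open>D\<close>.\<close>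

lemma C2_hypersurface_touching_ball:
  fixes D :: "'a::euclidean_space set"
  assumes "open D" "C2_hypersurface (frontier D)" and p: "p \<in> frontier D"
  obtains r u where "r > 0" "norm u = 1" "ball (p + r *\<^sub>R u) r \<subseteq> D"
proof -
  obtain U and \<rho> :: "'a \<Rightarrow> real" where U: "open U" "p \<in> U" and C2: "C2_on U \<rho>"
    and reg: "\<And>x. x \<in> U \<Longrightarrow> frechet_derivative \<rho> (at x) \<noteq> (\<lambda>_. 0)"
    and level: "frontier D \<inter> U = {x \<in> U. \<rho> x = 0}"
    using assms(2) p unfolding C2_hypersurface_def by metis
  obtain f' :: "'a \<Rightarrow> 'a \<Rightarrow>\<^sub>L real" and f''
    where f': "\<And>x. x \<in> U \<Longrightarrow> (\<rho> has_derivative blinfun_apply (f' x)) (at x)"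
      and f'': "\<And>x. x \<in> U \<Longrightarrow> (f' has_derivative blinfun_apply (f'' x)) (at x)"
    using C2 unfolding C2_on_def by blast
  have \<rho>p: "\<rho> p = 0" using level p U by blast
  \<comment> \<open>The gradient of \<open>\<rho>\<close> at \<open>p\<close>, as the Riesz
    representative of the derivative.\<close>
  define g where "g = adjoint (blinfun_apply (f' p)) 1"
  have g: "f' p x = g \<bullet> x" for x
    using adjoint_works[of "blinfun_apply (f' p)" x 1]
    by (simp add: g_def bounded_linear.linear blinfun.bounded_linear_right inner_commute)
  have "g \<noteq> 0"
    using reg[OF U(2)] frechet_derivative_at[OF f'[OF U(2)]] g by auto
  define l where "l = norm g"
  define e where "e = g /\<^sub>R l"
  have l: "l > 0" and e: "norm e = 1" and gle: "g = l *\<^sub>R e"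
    using \<open>g \<noteq> 0\<close> by (auto simp: l_def e_def)
  \<comment> \<open>The summand 1 absorbs the error in differentiating \<open>f'\<close> at
    \<open>p\<close>, taken with tolerance 1, and makes \<open>K\<close> positive.\<close>
  define K where "K = norm (f'' p) + 1"
  have K: "K > 0" unfolding K_def by (simp add: add_nonneg_pos)
  obtain d1 where d1: "d1 > 0"
    and lin: "\<And>y. norm (y - p) < d1 \<Longrightarrow> norm (f' y - f' p - f'' p (y - p)) \<le> 1 * norm (y - p)"
    using f''[OF U(2)] unfolding has_derivative_at_alt by (metis zero_less_one)
  have lip: "norm (f' y - f' p) \<le> K * norm (y - p)" if "norm (y - p) < d1" for y
  proof -
    have "norm (f' y - f' p) \<le> norm (f' y - f' p - f'' p (y - p)) + norm (f'' p (y - p))"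
      by (metis diff_add_cancel norm_triangle_ineq)
    also have "\<dots> \<le> norm (y - p) + norm (f'' p) * norm (y - p)"
      using lin[OF that] norm_blinfun[of "f'' p" "y - p"] by simp
    finally show ?thesis by (simp add: K_def algebra_simps)
  qed
  obtain d2 where d2: "d2 > 0" "ball p d2 \<subseteq> U"
    using U open_contains_ball by blast
  define d where "d = min d1 d2"
  have d: "d > 0" using d1 d2 by (simp add: d_def)
  \<comment> \<open>Mean value inequality for \<open>\<rho>\<close> minus its linear part at
    \<open>p\<close>: the derivative \<open>f' z - f' p\<close> has norm at most
    \<open>K * c\<close> on the ball of radius \<open>c\<close>.\<close>
  have remainder: "\<bar>(\<rho> x - g \<bullet> x) - (\<rho> y - g \<bullet> y)\<bar> \<le> K * c * norm (x - y)"
    if xy: "x \<in> cball p c" "y \<in> cball p c" and c: "c < d" for x y c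
  proof -
    have "norm ((\<rho> x - f' p x) - (\<rho> y - f' p y)) \<le> K * c * norm (x - y)"
    proof (rule differentiable_bound[OF convex_cball _ _ xy])
      fix z assume z: "z \<in> cball p c"
      then have z': "norm (z - p) \<le> c" by (simp add: dist_norm norm_minus_commute)
      have "z \<in> U" using z c d2 by (force simp: d_def)
      then have "((\<lambda>z. \<rho> z - f' p z) has_derivative (\<lambda>h. f' z h - f' p h)) (at z within cball p c)"
        by (intro has_derivative_diff has_derivative_at_withinI[OF f'] bounded_linear_imp_has_derivative
            blinfun.bounded_linear_right)
      moreover have "blinfun_apply (f' z - f' p) = (\<lambda>h. f' z h - f' p h)"
        by (simp add: fun_eq_iff blinfun.diff_left)
      ultimately show "((\<lambda>z. \<rho> z - f' p z) has_derivative blinfun_apply (f' z - f' p)) (at z within cball p c)"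
        by (simp only:)
      show "onorm (blinfun_apply (f' z - f' p)) \<le> K * c"
        using order_trans[OF lip[of z] mult_left_mono[OF z', of K]] z' c K
        by (simp add: d_def norm_blinfun.rep_eq[symmetric])
    qed
    then show ?thesis by (simp add: g)
  qed
  \<comment> \<open>The first bound keeps \<open>cball p (2 * r)\<close> within reach of
    \<open>remainder\<close>; the second gives \<open>2 * r * K < l\<close>, so that the linear term
    dominates the error.\<close>
  define r where "r = min (d / 4) (l / (4 * K))"
  have r: "r > 0" "2 * r < d" and "r \<le> l / (4 * K)"
    using d l K by (auto simp: r_def min_def)
  then have rK: "2 * r * K < l" using K l by (simp add: field_simps)
  obtain x where x: "x \<in> D" "dist x p < r"
    using p r unfolding frontier_def Diff_iff closure_approachable by blast
  have xU: "x \<in> U" using x r d2 by (force simp: d_def dist_commute)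
  have "x \<notin> frontier D" using x assms(1) by (simp add: frontier_def interior_open)
  then have "\<rho> x \<noteq> 0" using level xU by blast
  \<comment> \<open>The ball lies on the side of the level set on which \<open>D\<close> has points near \<open>p\<close>.\<close>
  define s where "s = sgn (\<rho> x)"
  define u where "u = s *\<^sub>R e"
  have s: "\<bar>s\<bar> = 1" "s * \<rho> x > 0" using \<open>\<rho> x \<noteq> 0\<close> by (auto simp: s_def sgn_real_def)
  have u: "norm u = 1" using s e by (simp add: u_def)
  have uu: "u \<bullet> u = 1" using u by (simp add: dot_square_norm)
  have est: "\<bar>(s * \<rho> y - s * \<rho> z) - l * (u \<bullet> (y - z))\<bar> \<le> K * c * norm (y - z)"
    if "y \<in> cball p c" "z \<in> cball p c" "c < d" for y z c
  proof -
    have "(s * \<rho> y - s * \<rho> z) - l * (u \<bullet> (y - z)) = s * ((\<rho> y - g \<bullet> y) - (\<rho> z - g \<bullet> z))"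
      by (simp add: gle u_def algebra_simps inner_diff_right)
    then show ?thesis using remainder[OF that] s by (simp add: abs_mult)
  qed
  \<comment> \<open>The point \<open>x\<close> of \<open>D\<close> may lie outside the ball.
    Translating it by \<open>r *\<^sub>R u\<close> brings it into the ball, because
    \<open>dist x p < r\<close>.\<close>
  define S where "S = ball (p + r *\<^sub>R u) r \<union> closed_segment x (x + r *\<^sub>R u)"
  have sub: "y \<in> cball p (2 * r) \<and> s * \<rho> y > 0" if "y \<in> ball (p + r *\<^sub>R u) r" for y
  proof -
    define v where "v = y - p"
    have v: "norm (v - r *\<^sub>R u) < r"
      using that by (simp add: v_def dist_norm norm_minus_commute algebra_simps)
    have "norm v \<le> norm (v - r *\<^sub>R u) + norm (r *\<^sub>R u)"
      by (metis diff_add_cancel norm_triangle_ineq)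
    then have nv: "norm v \<le> 2 * r" using v u r by simp
    have "(norm (v - r *\<^sub>R u))\<^sup>2 < r\<^sup>2" using v by (intro power_strict_mono) auto
    \<comment> \<open>Points of a ball tangent at \<open>p\<close> satisfy a quadratic bound by the
      height \<open>u \<bullet> v\<close>, so the error \<open>K * (norm v)\<^sup>2\<close> is below
      \<open>2 * r * K * (u \<bullet> v)\<close>.\<close>
    then have q: "(norm v)\<^sup>2 < 2 * r * (u \<bullet> v)"
      unfolding power2_norm_eq_inner using uu
      by (simp add: inner_diff_left inner_diff_right inner_commute power2_eq_square algebra_simps)
    have pos: "u \<bullet> v > 0"
    proof -
      have "0 < 2 * r * (u \<bullet> v)" using q zero_le_power2[of "norm v"] by linarith
      then show ?thesis using r by (simp add: zero_less_mult_iff)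
    qed
    have "\<bar>(s * \<rho> y - s * \<rho> p) - l * (u \<bullet> (y - p))\<bar> \<le> K * norm v * norm (y - p)"
      using nv r by (intro est) (auto simp: v_def dist_norm norm_minus_commute)
    then have "s * \<rho> y \<ge> l * (u \<bullet> v) - K * (norm v)\<^sup>2"
      by (simp add: \<rho>p v_def[symmetric] power2_eq_square algebra_simps)
    moreover have "K * (norm v)\<^sup>2 < K * (2 * r * (u \<bullet> v))" using q K by simp
    moreover have "2 * r * K * (u \<bullet> v) < l * (u \<bullet> v)" using rK pos by simp
    ultimately have "s * \<rho> y > 0" by (simp add: algebra_simps)
    then show ?thesis using nv by (simp add: v_def dist_norm norm_minus_commute)
  qed
  have seg: "y \<in> cball p (2 * r) \<and> s * \<rho> y > 0" if y: "y \<in> closed_segment x (x + r *\<^sub>R u)" for y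
  proof -
    obtain \<tau> where \<tau>: "0 \<le> \<tau>" "\<tau> \<le> 1" and "y = (1 - \<tau>) *\<^sub>R x + \<tau> *\<^sub>R (x + r *\<^sub>R u)"
      using y unfolding in_segment by blast
    then have y: "y = x + (\<tau> * r) *\<^sub>R u" by (simp add: algebra_simps)
    have \<tau>r: "0 \<le> \<tau> * r" "\<tau> * r \<le> r" using \<tau> r by (auto simp: mult_le_cancel_right1)
    have "norm (y - p) \<le> norm (x - p) + norm ((\<tau> * r) *\<^sub>R u)"
      using norm_triangle_ineq[of "x - p" "(\<tau> * r) *\<^sub>R u"] by (simp add: y algebra_simps)
    also have "norm ((\<tau> * r) *\<^sub>R u) = \<tau> * r" using u \<tau>r by simp
    also have "norm (x - p) + \<tau> * r \<le> r + r" using x(2) \<tau>r by (simp add: dist_norm)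
    finally have yc: "y \<in> cball p (2 * r)" by (simp add: dist_norm norm_minus_commute)
    \<comment> \<open>Moving in direction \<open>u\<close> changes \<open>s * \<rho>\<close> by at
      least \<open>(l - 2 * r * K) * (\<tau> * r)\<close>, so it stays positive from
      \<open>x\<close> onwards.\<close>
    have "\<bar>(s * \<rho> y - s * \<rho> x) - l * (u \<bullet> (y - x))\<bar> \<le> K * (2 * r) * norm (y - x)"
      using yc x(2) r by (intro est) (auto simp: dist_commute)
    then have "\<bar>(s * \<rho> y - s * \<rho> x) - l * (\<tau> * r)\<bar> \<le> 2 * r * K * (\<tau> * r)"
      using u uu \<tau> r by (simp add: y abs_mult algebra_simps)
    moreover have "2 * r * K * (\<tau> * r) \<le> l * (\<tau> * r)" using rK \<tau>r by (intro mult_right_mono) auto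
    ultimately have "s * \<rho> y > 0" using s(2) by linarith
    then show ?thesis using yc by simp
  qed
  have "S \<inter> frontier D = {}"
  proof -
    have "y \<notin> frontier D" if "y \<in> S" for y
    proof -
      have y: "y \<in> cball p (2 * r)" "s * \<rho> y > 0" using that sub seg unfolding S_def by blast+
      then have "y \<in> U" using r d2 by (force simp: d_def)
      then have "\<rho> y = 0" if "y \<in> frontier D" using that level by blast
      then show ?thesis using y(2) by auto
    qed
    then show ?thesis by blast
  qed
  moreover have "connected S"
    unfolding S_def
  proof (rule connected_Un)
    have "x + r *\<^sub>R u \<in> ball (p + r *\<^sub>R u) r" using x(2) by (simp add: dist_commute)
    then show "ball (p + r *\<^sub>R u) r \<inter> closed_segment x (x + r *\<^sub>R u) \<noteq> {}"
      using ends_in_segment(2) by blast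
  qed auto
  moreover have "S \<inter> D \<noteq> {}" using x by (auto simp: S_def)
  ultimately have "S \<subseteq> D" using connected_Int_frontier by blast
  then show ?thesis using that[OF r(1) u] by (auto simp: S_def)
qed

section \<open>Section volumes between cubes\<close>

lemma card_orthonormal_basis_hyperplane:
  fixes \<omega> :: "'a::euclidean_space"
  assumes "orthonormal_basis_of B {x. \<omega> \<bullet> x = 0}" "\<omega> \<noteq> 0"
  shows "card B = DIM('a) - 1"
proof -
  have "0 \<notin> B" using assms(1) by (auto simp: orthonormal_basis_of_def)
  then have "independent B"
    using assms(1) by (simp add: orthonormal_basis_of_def pairwise_orthogonal_independent)
  then have "card B = dim (span B)" by (simp add: dim_eq_card_independent dim_span)
  then show ?thesis
    using assms dim_hyperplane[of \<omega>] by (simp add: orthonormal_basis_of_def del: dim_span)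
qed

text \<open>In orthonormal coordinates of the hyperplane the section lies between two cubes of
  half-sides \<open>b\<close> and \<open>a\<close>. Cubes replace balls because only the order of
  magnitude matters and their product measure is immediate.\<close>

lemma section_volume_bounds:
  fixes \<omega> :: "'a::euclidean_space"
  assumes \<omega>: "norm \<omega> = 1" and D: "D \<in> sets borel" and ab: "0 \<le> a" "0 \<le> b"
    and up: "\<And>x. x \<in> D \<Longrightarrow> \<omega> \<bullet> x = t \<Longrightarrow> norm (x - t *\<^sub>R \<omega>) \<le> a"
    and low: "\<And>x. \<omega> \<bullet> x = t \<Longrightarrow> norm (x - t *\<^sub>R \<omega>) \<le> real (DIM('a) - 1) * b \<Longrightarrow> x \<in> D"
  shows "section_volume D \<omega> t \<le> (2 * a) ^ (DIM('a) - 1)"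
    and "(2 * b) ^ (DIM('a) - 1) \<le> section_volume D \<omega> t"
proof -
  define B where "B = (SOME B. orthonormal_basis_of B {x. \<omega> \<bullet> x = 0})"
  have onb: "orthonormal_basis_of B {x. \<omega> \<bullet> x = 0}"
    unfolding B_def by (rule someI_ex, rule orthonormal_basis_of_exists, rule subspace_hyperplane)
  have fin: "finite B" using finite_orthonormal_basis_of[OF onb] .
  have card: "card B = DIM('a) - 1"
    using card_orthonormal_basis_hyperplane[OF onb] \<omega> by fastforce
  have nB: "norm v = 1" if "v \<in> B" for v using onb that by (auto simp: orthonormal_basis_of_def)
  have orth: "v \<bullet> w = 0" if "v \<in> B" "w \<in> B" "v \<noteq> w" for v w
    using onb that unfolding orthonormal_basis_of_def pairwise_def orthogonal_def by blast
  have perp: "\<omega> \<bullet> v = 0" if "v \<in> B" for v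
    using onb span_base[OF that] by (auto simp: orthonormal_basis_of_def)
  define M where "M = (\<Pi>\<^sub>M b\<in>B. (lborel :: real measure))"
  define T where "T = (\<lambda>c. t *\<^sub>R \<omega> + (\<Sum>b\<in>B. c b *\<^sub>R b))"
  have T: "T \<in> measurable M borel"
    unfolding T_def M_def by measurable
  define Q where "Q = (\<lambda>a. \<Pi>\<^sub>E v\<in>B. {-a..a::real})"
  interpret P: finite_product_sigma_finite "\<lambda>_. lborel :: real measure" B
    by standard (rule fin)
  have Q_sets: "Q a \<in> sets M" for a
    unfolding Q_def M_def using fin by (intro sets_PiM_I_finite) auto
  have Q: "emeasure M (Q a) = ennreal ((2 * a) ^ card B)" if "0 \<le> a" for a
    unfolding Q_def M_def using that
    by (subst P.measure_times) (auto simp: ennreal_power)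
  define E where "E = T -` (D \<inter> {x. \<omega> \<bullet> x = t}) \<inter> space M"
  have DH: "D \<inter> {x. \<omega> \<bullet> x = t} \<in> sets borel"
    using D by (simp add: borel_closed closed_hyperplane sets.Int)
  have E_sets: "E \<in> sets M" unfolding E_def using T DH by (rule measurable_sets)
  have vol: "section_volume D \<omega> t = measure M E"
    unfolding section_volume_def hyperplane_measure_def Let_def B_def[symmetric]
    using measure_distr[OF T DH] by (simp add: E_def M_def T_def)
  have coord: "\<bar>c v\<bar> \<le> norm (T c - t *\<^sub>R \<omega>)" if "v \<in> B" for c v
  proof -
    have "(\<Sum>b\<in>B. c b *\<^sub>R b) \<bullet> v = (\<Sum>b\<in>B. if b = v then c v else 0)"
      unfolding inner_sum_left
    proof (rule sum.cong[OF refl])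
      fix b assume "b \<in> B"
      then show "(c b *\<^sub>R b) \<bullet> v = (if b = v then c v else 0)"
        using orth that nB[OF that] by (auto simp: dot_square_norm)
    qed
    also have "\<dots> = c v" using fin that by simp
    finally have "c v = (T c - t *\<^sub>R \<omega>) \<bullet> v" by (simp add: T_def)
    then show ?thesis
      using Cauchy_Schwarz_ineq2[of "T c - t *\<^sub>R \<omega>" v] nB[OF that] by simp
  qed
  have plane: "\<omega> \<bullet> T c = t" for c
    using \<omega> perp by (simp add: T_def inner_add_right inner_sum_right dot_square_norm)
  have EQ: "E \<subseteq> Q a"
  proof
    fix c assume c: "c \<in> E"
    then have "T c \<in> D" by (simp add: E_def)
    then have "\<bar>c v\<bar> \<le> a" if "v \<in> B" for v
      using coord[OF that, of c] up[OF _ plane[of c]] by linarith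
    moreover have "c \<in> extensional B"
      using c by (auto simp: E_def M_def space_PiM PiE_def)
    ultimately show "c \<in> Q a"
      by (auto simp: Q_def PiE_def abs_le_iff minus_le_iff)
  qed
  have QE: "Q b \<subseteq> E"
  proof
    fix c assume c: "c \<in> Q b"
    \<comment> \<open>The triangle inequality over the \<open>DIM('a) - 1\<close> basis vectors is
      the source of the factor in the assumption \<open>low\<close>.\<close>
    have "norm (T c - t *\<^sub>R \<omega>) \<le> (\<Sum>v\<in>B. norm (c v *\<^sub>R v))"
      using norm_sum[of "\<lambda>b. c b *\<^sub>R b" B] by (simp only: T_def add_diff_cancel_left')
    also have "\<dots> \<le> (\<Sum>v\<in>B. b)"
      using c nB by (intro sum_mono) (auto simp: Q_def PiE_def Pi_def abs_le_iff minus_le_iff)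
    finally have "T c \<in> D" using low[OF plane] by (simp add: card)
    moreover have "c \<in> space M" using c Q_sets[THEN sets.sets_into_space] by blast
    ultimately show "c \<in> E" using plane by (simp add: E_def)
  qed
  \<comment> \<open>\<open>measure\<close> is 0 on sets of infinite measure, so monotonicity needs
    \<open>E\<close> to have finite measure; the outer cube supplies this.\<close>
  have Qa: "Q a \<in> fmeasurable M" by (rule fmeasurableI[OF Q_sets]) (simp add: Q[OF ab(1)])
  have E: "E \<in> fmeasurable M" by (rule fmeasurableI2[OF Qa EQ E_sets])
  have "measure M E \<le> measure M (Q a)"
    by (rule measure_mono_fmeasurable[OF EQ E_sets Qa])
  then show "section_volume D \<omega> t \<le> (2 * a) ^ (DIM('a) - 1)"
    by (simp add: vol measure_def Q ab card)
  have "measure M (Q b) \<le> measure M E"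
    by (rule measure_mono_fmeasurable[OF QE Q_sets E])
  then show "(2 * b) ^ (DIM('a) - 1) \<le> section_volume D \<omega> t"
    by (simp add: vol measure_def Q ab card)
qed

section \<open>Orders of vanishing of polynomials\<close>

text \<open>The square of a polynomial vanishes to even order.\<close>
lemma poly_square_not_odd_order:
  fixes q :: "real poly"
  assumes "odd m" "c > 0" "\<delta> > 0"
    and low: "\<And>s. 0 < s \<Longrightarrow> s < \<delta> \<Longrightarrow> c * s ^ m \<le> (poly q (R - s))\<^sup>2"
    and up: "\<And>s. 0 < s \<Longrightarrow> s < \<delta> \<Longrightarrow> (poly q (R - s))\<^sup>2 \<le> C * s ^ m"
  shows False
proof -
  have "q \<noteq> 0"
  proof
    assume "q = 0"
    then have "c * (\<delta> / 2) ^ m \<le> 0" using low[of "\<delta> / 2"] assms(3) by simp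
    moreover have "c * (\<delta> / 2) ^ m > 0" using assms(2,3) by simp
    ultimately show False by linarith
  qed
  \<comment> \<open>Splitting off the zero at \<open>R\<close> leaves \<open>h\<close> with
    \<open>poly h R \<noteq> 0\<close>; the square then has exact order \<open>2 * k\<close> in
    \<open>s\<close>, which cannot equal the odd \<open>m\<close>.\<close>
  define k where "k = order R q"
  obtain h where qh: "q = [:- R, 1:] ^ k * h" and "\<not> [:- R, 1:] dvd h"
    using order_decomp[OF \<open>q \<noteq> 0\<close>] unfolding k_def by blast
  then have h: "poly h R \<noteq> 0" by (simp add: poly_eq_0_iff_dvd)
  have sq: "(poly q (R - s))\<^sup>2 = s ^ (2 * k) * (poly h (R - s))\<^sup>2" for s
    by (simp add: qh power_mult_distrib power_mult power_commutes mult.commute[of 2]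
        flip: power_mult)
  have near: "eventually (\<lambda>s. 0 < s \<and> s < \<delta>) (at_right 0)"
    using assms(3) by (auto simp: eventually_at_right)
  have lim: "((\<lambda>s. (poly h (R - s))\<^sup>2) \<longlongrightarrow> (poly h R)\<^sup>2) (at_right 0)"
    by (auto intro!: tendsto_eq_intros)
  consider "2 * k < m" | "m < 2 * k" using assms(1) by (metis dvd_triv_left linorder_neqE_nat)
  then show False
  proof cases
    case 1
    \<comment> \<open>Dividing the upper bound by \<open>s ^ (2 * k)\<close> leaves a positive power
      of \<open>s\<close>, which forces \<open>poly h R = 0\<close> in the limit.\<close>
    have "((\<lambda>s::real. C * s ^ (m - 2 * k)) \<longlongrightarrow> C * 0 ^ (m - 2 * k)) (at_right 0)"
      by (intro tendsto_intros)
    moreover have "eventually (\<lambda>s. (poly h (R - s))\<^sup>2 \<le> C * s ^ (m - 2 * k)) (at_right 0)"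
      using near
    proof eventually_elim
      case (elim s)
      have "s ^ (2 * k) * (poly h (R - s))\<^sup>2 \<le> s ^ (2 * k) * (C * s ^ (m - 2 * k))"
        using up[of s] elim 1 by (simp add: sq mult.left_commute flip: power_add)
      then show ?case using elim by simp
    qed
    ultimately have "(poly h R)\<^sup>2 \<le> C * 0 ^ (m - 2 * k)"
      using lim by (intro tendsto_le[OF trivial_limit_at_right_real])
    then show False using h 1 by (simp add: power_0_left)
  next
    case 2
    \<comment> \<open>Dividing the lower bound by \<open>s ^ m\<close> leaves a quantity tending to
      0 above the positive constant \<open>c\<close>.\<close>
    have "((\<lambda>s::real. s ^ (2 * k - m) * (poly h (R - s))\<^sup>2) \<longlongrightarrow> 0 ^ (2 * k - m) * (poly h R)\<^sup>2)
        (at_right 0)"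
      by (intro tendsto_intros lim)
    moreover have "eventually (\<lambda>s. c \<le> s ^ (2 * k - m) * (poly h (R - s))\<^sup>2) (at_right 0)"
      using near
    proof eventually_elim
      case (elim s)
      have "s ^ m * c \<le> s ^ m * (s ^ (2 * k - m) * (poly h (R - s))\<^sup>2)"
        using low[of s] elim 2 by (simp add: sq mult.commute flip: power_add mult.assoc)
      then show ?case using elim by simp
    qed
    ultimately have "c \<le> 0 ^ (2 * k - m) * (poly h R)\<^sup>2"
      by (rule tendsto_lowerbound) simp
    then show False using assms(2) 2 by (simp add: power_0_left)
  qed
qed

section \<open>Sections near a farthest boundary point\<close>

lemma not_polynomially_integrable_even_dim:
  fixes D :: "'a::euclidean_space set"
  assumes even: "even DIM('a)" and dom: "is_domain D" and bdd: "bounded D"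
    and C2: "C2_hypersurface (frontier D)"
  shows "\<not> polynomially_integrable D"
proof
  assume "polynomially_integrable D"
  then obtain N and a :: "nat \<Rightarrow> 'a \<Rightarrow> real"
    where poly: "\<And>\<omega> t. \<omega> \<in> sphere 0 1 \<Longrightarrow> D \<inter> {x. \<omega> \<bullet> x = t} \<noteq> {} \<Longrightarrow>
                    section_volume D \<omega> t = (\<Sum>j\<le>N. a j \<omega> * t ^ j)"
    unfolding polynomially_integrable_def by blast
  have D: "open D" "D \<noteq> {}" using dom by (auto simp: is_domain_def)
  have "\<exists>p\<in>closure D. \<forall>y\<in>closure D. norm y \<le> norm p"
    using bdd D by (intro continuous_attains_sup) (auto intro: continuous_intros)
  then obtain p where p: "p \<in> closure D" and far: "\<And>y. y \<in> closure D \<Longrightarrow> norm y \<le> norm p"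
    by blast
  define R where "R = norm p"
  have DR: "D \<subseteq> cball 0 R"
    using far closure_subset by (force simp: R_def)
  \<comment> \<open>An open subset of the closed ball avoids the sphere, which puts \<open>p\<close>
    on the frontier.\<close>
  have "D \<subseteq> ball 0 R"
    using interior_maximal[OF DR D(1)] by (simp add: interior_cball)
  then have "p \<notin> D" by (auto simp: R_def)
  then have "p \<in> frontier D" using p D by (simp add: frontier_def interior_open)
  then obtain r u where r: "r > 0" and u: "norm u = 1" and ball: "ball (p + r *\<^sub>R u) r \<subseteq> D"
    using C2_hypersurface_touching_ball[OF D(1) C2] by metis
  \<comment> \<open>Since \<open>u\<close> points into \<open>D\<close>, this is the outward normal
    at \<open>p\<close>.\<close>
  define \<omega> where "\<omega> = - u"
  have \<omega>: "norm \<omega> = 1" using u by (simp add: \<omega>_def)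
  then have \<omega>\<omega>: "\<omega> \<bullet> \<omega> = 1" by (simp add: dot_square_norm)
  have "ball (p - r *\<^sub>R \<omega>) r \<subseteq> cball 0 R" using ball DR by (auto simp: \<omega>_def)
  then have inside: "norm (p - r *\<^sub>R \<omega>) \<le> R - r"
    using r by (simp add: ball_subset_cball_iff)
  \<comment> \<open>Internal tangency of the two balls at \<open>p\<close> forces their centres and \<open>p\<close> to be collinear.\<close>
  have pR: "p = R *\<^sub>R \<omega>"
  proof -
    have R0: "R \<ge> 0" by (simp add: R_def)
    have pp: "p \<bullet> p = R\<^sup>2" by (simp add: R_def dot_square_norm)
    \<comment> \<open>Squaring yields \<open>R \<le> p \<bullet> \<omega>\<close>. As
      \<open>norm p = R\<close>, this is the equality case of Cauchy-Schwarz.\<close>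
    have "(norm (p - r *\<^sub>R \<omega>))\<^sup>2 \<le> (R - r)\<^sup>2" using inside by (intro power_mono) auto
    then have "2 * r * R \<le> 2 * r * (p \<bullet> \<omega>)"
      unfolding power2_norm_eq_inner using pp \<omega>\<omega>
      by (simp add: inner_diff_left inner_diff_right inner_commute power2_eq_square algebra_simps)
    then have "R \<le> p \<bullet> \<omega>" using r by simp
    then have "R * R \<le> R * (p \<bullet> \<omega>)" using R0 by (intro mult_left_mono)
    then have "(p - R *\<^sub>R \<omega>) \<bullet> (p - R *\<^sub>R \<omega>) \<le> 0"
      using pp \<omega>\<omega> by (simp add: inner_diff_left inner_diff_right inner_commute
          power2_eq_square algebra_simps)
    then have "(p - R *\<^sub>R \<omega>) \<bullet> (p - R *\<^sub>R \<omega>) = 0"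
      by (rule antisym) (rule inner_ge_zero)
    then have "p - R *\<^sub>R \<omega> = 0" by (simp only: inner_eq_zero_iff)
    then show ?thesis by simp
  qed
  have Rr: "r \<le> R" using inside norm_ge_zero[of "p - r *\<^sub>R \<omega>"] by linarith
  have ball': "ball ((R - r) *\<^sub>R \<omega>) r \<subseteq> D"
    using ball by (simp add: pR \<omega>_def algebra_simps)
  define m where "m = DIM('a) - 1"
  have m: "odd m" "m > 0"
  proof -
    have "DIM('a) \<noteq> 1" using even by auto
    then have "2 \<le> DIM('a)" using DIM_positive[where 'a='a] by linarith
    then show "odd m" "m > 0" using even by (auto simp: m_def)
  qed
  \<comment> \<open>Pythagoras along the axis through \<open>\<omega>\<close>, on which both ball
    centres lie.\<close>
  have split: "(norm (x - c *\<^sub>R \<omega>))\<^sup>2 = (norm (x - t *\<^sub>R \<omega>))\<^sup>2 + (t - c)\<^sup>2"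
    if "\<omega> \<bullet> x = t" for x t c
    unfolding power2_norm_eq_inner using that \<omega>\<omega>
    by (simp add: inner_diff_left inner_diff_right inner_commute power2_eq_square algebra_simps)
  define q where "q = (\<Sum>j\<le>N. monom (a j \<omega>) j)"
  \<comment> \<open>Squaring turns the half-integer order \<open>m / 2\<close> into the integer
    order \<open>m\<close>, so no real powers are needed.\<close>
  have bounds: "(4 * r / (real m)\<^sup>2) ^ m * s ^ m \<le> (Polynomial.poly q (R - s))\<^sup>2 \<and>
      (Polynomial.poly q (R - s))\<^sup>2 \<le> (8 * R) ^ m * s ^ m" if s: "0 < s" "s < r" for s
  proof -
    define t where "t = R - s"
    \<comment> \<open>The section of the outer ball has radius
      \<open>sqrt (2 * R * s - s\<^sup>2)\<close>, at most \<open>\<alpha>\<close>. That of the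
      inner ball has radius \<open>sqrt (2 * r * s - s\<^sup>2)\<close>, which exceeds
      \<open>sqrt (r * s)\<close> for \<open>s < r\<close>; dividing by \<open>m\<close> offsets the
      dimension factor in \<open>section_volume_bounds\<close>.\<close>
    define \<alpha> where "\<alpha> = sqrt (2 * R * s)"
    define \<beta> where "\<beta> = sqrt (r * s) / m"
    have \<alpha>2: "\<alpha>\<^sup>2 = 2 * R * s" and \<beta>2: "\<beta>\<^sup>2 = r * s / (real m)\<^sup>2"
      and \<alpha>\<beta>: "\<alpha> \<ge> 0" "\<beta> \<ge> 0"
      using s r Rr by (auto simp: \<alpha>_def \<beta>_def power_divide)
    have mem: "x \<in> D" if x: "\<omega> \<bullet> x = t" "norm (x - t *\<^sub>R \<omega>) \<le> real m * \<beta>" for x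
    proof -
      have "(norm (x - t *\<^sub>R \<omega>))\<^sup>2 \<le> (real m * \<beta>)\<^sup>2" using x by (intro power_mono) auto
      also have "\<dots> = r * s" using \<beta>2 m by (simp add: power_mult_distrib)
      finally have "(norm (x - (R - r) *\<^sub>R \<omega>))\<^sup>2 \<le> r * s + (r - s)\<^sup>2"
        using split[OF x(1), of "R - r"] by (simp add: t_def)
      also have "\<dots> = r\<^sup>2 - s * (r - s)" by (simp add: power2_eq_square algebra_simps)
      also have "\<dots> < r\<^sup>2" using s by simp
      finally have "norm (x - (R - r) *\<^sub>R \<omega>) < r"
        using r by (simp add: power_less_imp_less_base)
      then show ?thesis using ball' by (auto simp: dist_norm norm_minus_commute)
    qed
    have \<alpha>: "norm (x - t *\<^sub>R \<omega>) \<le> \<alpha>" if x: "x \<in> D" "\<omega> \<bullet> x = t" for x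
    proof -
      have "norm x \<le> R" using x DR by auto
      then have "(norm (x - t *\<^sub>R \<omega>))\<^sup>2 + t\<^sup>2 \<le> R\<^sup>2"
        using split[OF x(2), of 0] power_mono[of "norm x" R 2] by simp
      then have "(norm (x - t *\<^sub>R \<omega>))\<^sup>2 \<le> 2 * R * s - s\<^sup>2"
        by (simp add: t_def power2_eq_square algebra_simps)
      then have "(norm (x - t *\<^sub>R \<omega>))\<^sup>2 \<le> \<alpha>\<^sup>2"
        unfolding \<alpha>2 using zero_le_power2[of s] by linarith
      then show ?thesis using \<alpha>\<beta>(1) by (rule power2_le_imp_le)
    qed
    have vol: "section_volume D \<omega> t \<le> (2 * \<alpha>) ^ m" "(2 * \<beta>) ^ m \<le> section_volume D \<omega> t"
      unfolding m_def
      by (rule section_volume_bounds[OF \<omega> borel_open[OF D(1)] \<alpha>\<beta> \<alpha> mem[unfolded m_def]]; assumption)+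
    \<comment> \<open>The axis point shows that the hyperplane meets \<open>D\<close>, so the
      polynomial formula applies at \<open>t\<close>.\<close>
    have "t *\<^sub>R \<omega> \<in> D" using mem[of "t *\<^sub>R \<omega>"] \<omega>\<omega> \<alpha>\<beta> by simp
    then have "D \<inter> {x. \<omega> \<bullet> x = t} \<noteq> {}" using \<omega>\<omega> by force
    then have V: "section_volume D \<omega> t = Polynomial.poly q (R - s)"
      using poly[of \<omega> t] \<omega> by (simp add: q_def poly_sum poly_monom t_def)
    have V0: "section_volume D \<omega> t \<ge> 0" by (simp add: section_volume_def)
    have "((2 * \<beta>) ^ m)\<^sup>2 \<le> (section_volume D \<omega> t)\<^sup>2"
      by (rule power_mono[OF vol(2)]) (intro zero_le_power mult_nonneg_nonneg \<alpha>\<beta>, simp)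
    moreover have "(section_volume D \<omega> t)\<^sup>2 \<le> ((2 * \<alpha>) ^ m)\<^sup>2"
      by (rule power_mono[OF vol(1) V0])
    moreover have "((2 * z) ^ m)\<^sup>2 = (4 * z\<^sup>2) ^ m" for z :: real
    proof -
      have "((2 * z) ^ m)\<^sup>2 = ((2 * z)\<^sup>2) ^ m" by (metis power_mult mult.commute)
      then show ?thesis by (simp add: power_mult_distrib)
    qed
    moreover have "(4 * \<alpha>\<^sup>2) ^ m = (8 * R) ^ m * s ^ m"
      unfolding \<alpha>2 power_mult_distrib[symmetric] by (simp add: mult.assoc)
    moreover have "(4 * \<beta>\<^sup>2) ^ m = (4 * r / (real m)\<^sup>2) ^ m * s ^ m"
      unfolding \<beta>2 power_mult_distrib[symmetric] by (simp add: mult.assoc)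
    ultimately show ?thesis by (simp only: V simp_thms)
  qed
  show False
    using bounds r m
    by (intro poly_square_not_odd_order[of m "(4 * r / (real m)\<^sup>2) ^ m" r q R "(8 * R) ^ m"]) auto
qed

theorem theorem2:
  assumes "even CARD('n::finite)"
  shows "\<not> (\<exists>D :: (real ^ 'n) set.
            is_domain D \<and> bounded D \<and> C2_hypersurface (frontier D) \<and> polynomially_integrable D)"
proof -
  have "even DIM(real ^ 'n)" using assms by simp
  then show ?thesis using not_polynomially_integrable_even_dim by blast
qed

end
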